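(* Let $\beta_0>0$ and $\beta_2\in(\beta_0,2\beta_0)$. Then there exists $B>\beta_0$ (depending on $\beta_0,\beta_2$) such that for every $\beta_1>B$ and every $n\ge5$, the shape process $H^n$ with parameter $(\beta_0,\beta_1,\beta_2)$ is transient.
   Context: For $n\ge2$ and $\beta=(\beta_0,\beta_1,\beta_2)\in(0,\infty)^3$: for $x\in\mathbb{N}^n$, with zero boundary convention $x(0)=x(n+1)=0$, let $V_j(x)=\mathbf 1_{\{x(j-1)>x(j)\}}+\mathbf 1_{\{x(j+1)>x(j)\}}$. The crystal process $X^n$ is the continuous-time Markov chain on $\mathbb{N}^n$ jumping from $x$ to $x+e_j$ at rate $\beta_{V_j(x)}$, no other transitions; its shape process is $H^n_t=(X^n_t(1)-X^n_t(2),\dots,X^n_t(n-1)-X^n_t(n))\in\mathbb{Z}^{n-1}$, a Markov chain. *)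

theory Defs
  imports "HOL-Analysis.Analysis"
begin

text \<open>Shape configurations h in Z^(n-1) are encoded as functions nat => int,
  with h i = H(i) = x(i) - x(i+1) for 1 <= i <= n-1 and h i = 0 otherwise.\<close>

definition valid_shape :: "nat \<Rightarrow> (nat \<Rightarrow> int) \<Rightarrow> bool" where
  "valid_shape n h \<longleftrightarrow> (\<forall>i. (i = 0 \<or> n \<le> i) \<longrightarrow> h i = 0)"

definition betaV :: "real \<Rightarrow> real \<Rightarrow> real \<Rightarrow> nat \<Rightarrow> real" where
  "betaV b0 b1 b2 v = (if v = 0 then b0 else if v = 1 then b1 else b2)"

text \<open>V_j(x) expressed through the shape h of x (zero boundary x(0)=x(n+1)=0):
  x(j-1) > x(j) iff j >= 2 and h(j-1) > 0;  x(j+1) > x(j) iff j <= n-1 and h(j) < 0.\<close>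
definition Vsh :: "nat \<Rightarrow> (nat \<Rightarrow> int) \<Rightarrow> nat \<Rightarrow> nat" where
  "Vsh n h j = (if 2 \<le> j \<and> h (j - 1) > 0 then 1 else 0)
             + (if j + 1 \<le> n \<and> h j < 0 then 1 else 0)"

text \<open>Effect on the shape of the crystal jump x -> x + e_j.\<close>
definition step :: "nat \<Rightarrow> (nat \<Rightarrow> int) \<Rightarrow> nat \<Rightarrow> (nat \<Rightarrow> int)" where
  "step n h j =
     (let h1 = (if 2 \<le> j then h((j - 1) := h (j - 1) - 1) else h)
      in if j + 1 \<le> n then h1(j := h1 j + 1) else h1)"

definition rate :: "nat \<Rightarrow> (nat \<Rightarrow> real) \<Rightarrow> (nat \<Rightarrow> int) \<Rightarrow> nat \<Rightarrow> real" where
  "rate n b h j = b (Vsh n h j)"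

definition jprob :: "nat \<Rightarrow> (nat \<Rightarrow> real) \<Rightarrow> (nat \<Rightarrow> int) \<Rightarrow> nat \<Rightarrow> real" where
  "jprob n b h j = rate n b h j / (\<Sum>i\<in>{1..n}. rate n b h i)"

fun walk :: "nat \<Rightarrow> (nat \<Rightarrow> int) \<Rightarrow> nat list \<Rightarrow> (nat \<Rightarrow> int)" where
  "walk n h [] = h"
| "walk n h (j # js) = walk n (step n h j) js"

fun pathprob :: "nat \<Rightarrow> (nat \<Rightarrow> real) \<Rightarrow> (nat \<Rightarrow> int) \<Rightarrow> nat list \<Rightarrow> real" where
  "pathprob n b h [] = 1"
| "pathprob n b h (j # js) = jprob n b h j * pathprob n b (step n h j) js"

definition first_returns :: "nat \<Rightarrow> (nat \<Rightarrow> int) \<Rightarrow> nat \<Rightarrow> nat list set" where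
  "first_returns n h k = {js. set js \<subseteq> {1..n} \<and> length js = k \<and> walk n h js = h
                          \<and> (\<forall>i. 0 < i \<and> i < k \<longrightarrow> walk n h (take i js) \<noteq> h)}"

definition return_prob :: "nat \<Rightarrow> (nat \<Rightarrow> real) \<Rightarrow> (nat \<Rightarrow> int) \<Rightarrow> ennreal" where
  "return_prob n b h = (\<Sum>k. ennreal (\<Sum>js\<in>first_returns n h (Suc k). pathprob n b h js))"

definition shape_transient :: "nat \<Rightarrow> (nat \<Rightarrow> real) \<Rightarrow> bool" where
  "shape_transient n b \<longleftrightarrow> (\<forall>h. valid_shape n h \<longrightarrow> return_prob n b h < 1)"

end

theory Submission
  imports Defs
begin

text \<open>
  Cut the \<open>n\<close> sites into plateaus of width 2 or 3 separated by single sites, the holes. As long as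
  every hole lies strictly below both its neighbours, holes rise at rate \<open>\<beta>\<^sub>2\<close> and the plateaus evolve
  independently of each other and of the holes. For large \<open>\<beta>\<^sub>1\<close> a jump on a flat plateau of width
  \<open>w\<close> is at once copied by the rest of the plateau, so the plateau rises at speed close to
  \<open>w \<beta>\<^sub>0 \<ge> 2 \<beta>\<^sub>0 > \<beta>\<^sub>2\<close>, and the holes deepen linearly. A pit inside a plateau of width 3 fills up,
  because its one-site walls rise at rate \<open>\<beta>\<^sub>0 < \<beta>\<^sub>2\<close> only. This becomes a positive superharmonic
  function with infimum 0: the minimum of 1 and the sum, over all pairs of a hole and an adjacent
  plateau, of \<open>exp (\<theta> (1 + hole height - plateau level))\<close>, where the level of a plateau is a corrected
  minimum height whose drift exceeds \<open>\<beta>\<^sub>2\<close> in every state. Since only two widths occur, the bound on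
  \<open>\<beta>\<^sub>1\<close> does not depend on \<open>n\<close>.
\<close>

section \<open>Transience from a superharmonic function\<close>

text \<open>Time 0 counts as a hit here, unlike in \<open>first_returns\<close>: started at
  \<open>h\<close>, only the empty path qualifies. First returns thus become first hits after one
  step.\<close>

definition first_hits :: "nat \<Rightarrow> (nat \<Rightarrow> int) \<Rightarrow> (nat \<Rightarrow> int) \<Rightarrow> nat \<Rightarrow> nat list set" where
  "first_hits n h x k = {js. set js \<subseteq> {1..n} \<and> length js = k \<and> walk n x js = h
                          \<and> (\<forall>i<k. walk n x (take i js) \<noteq> h)}"

definition hit_prob :: "nat \<Rightarrow> (nat \<Rightarrow> real) \<Rightarrow> (nat \<Rightarrow> int) \<Rightarrow> nat \<Rightarrow> (nat \<Rightarrow> int) \<Rightarrow> real" where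
  "hit_prob n b h k x = (\<Sum>js\<in>first_hits n h x k. pathprob n b x js)"

lemma finite_first_hits: "finite (first_hits n h x k)"
  by (rule finite_subset[OF _ finite_lists_length_eq[of "{1..n}" k]])
     (auto simp: first_hits_def)

section \<open>First-step decomposition of path sums\<close>

lemma first_returns_Suc:
  "first_returns n h (Suc k) = (\<Union>j\<in>{1..n}. (#) j ` first_hits n h (step n h j) k)"
proof (intro set_eqI iffI)
  fix js assume js: "js \<in> first_returns n h (Suc k)"
  then obtain j js' where eq: "js = j # js'"
    by (cases js) (auto simp: first_returns_def)
  have "walk n (step n h j) (take i js') \<noteq> h" if "i < k" for i
    using js that unfolding first_returns_def eq
    by (auto dest!: spec[of _ "Suc i"])
  with js show "js \<in> (\<Union>j\<in>{1..n}. (#) j ` first_hits n h (step n h j) k)"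
    by (intro UN_I[of j] image_eqI[of _ _ js']) (auto simp: first_returns_def first_hits_def eq)
next
  fix js assume "js \<in> (\<Union>j\<in>{1..n}. (#) j ` first_hits n h (step n h j) k)"
  then show "js \<in> first_returns n h (Suc k)"
    by (auto simp: first_returns_def first_hits_def take_Cons split: nat.splits)
qed

lemma first_hits_Suc:
  assumes "x \<noteq> h"
  shows "first_hits n h x (Suc k) = (\<Union>j\<in>{1..n}. (#) j ` first_hits n h (step n x j) k)"
proof (intro set_eqI iffI)
  fix js assume js: "js \<in> first_hits n h x (Suc k)"
  then obtain j js' where eq: "js = j # js'"
    by (cases js) (auto simp: first_hits_def)
  have "walk n (step n x j) (take i js') \<noteq> h" if "i < k" for i
    using js that unfolding first_hits_def eq
    by (auto dest!: spec[of _ "Suc i"])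
  with js show "js \<in> (\<Union>j\<in>{1..n}. (#) j ` first_hits n h (step n x j) k)"
    by (intro UN_I[of j] image_eqI[of _ _ js']) (auto simp: first_hits_def eq)
next
  fix js assume "js \<in> (\<Union>j\<in>{1..n}. (#) j ` first_hits n h (step n x j) k)"
  then show "js \<in> first_hits n h x (Suc k)"
    using assms by (auto simp: first_hits_def take_Cons split: nat.splits)
qed

lemma sum_pathprob_Cons:
  "(\<Sum>js\<in>(\<Union>j\<in>{1..n}. (#) j ` first_hits n h (step n x j) k). pathprob n b x js) =
   (\<Sum>j\<in>{1..n}. jprob n b x j * hit_prob n b h k (step n x j))"
proof -
  have "(\<Sum>js\<in>(\<Union>j\<in>{1..n}. (#) j ` first_hits n h (step n x j) k). pathprob n b x js) =
        (\<Sum>j\<in>{1..n}. \<Sum>js\<in>(#) j ` first_hits n h (step n x j) k. pathprob n b x js)"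
    by (rule sum.UNION_disjoint) (auto simp: finite_first_hits)
  also have "\<dots> = (\<Sum>j\<in>{1..n}. jprob n b x j * hit_prob n b h k (step n x j))"
    by (simp add: hit_prob_def sum.reindex sum_distrib_left)
  finally show ?thesis .
qed

lemma sum_jprob:
  assumes "\<And>v. b v > 0" "n > 0"
  shows "(\<Sum>j\<in>{1..n}. jprob n b x j) = 1"
proof -
  have "(\<Sum>i\<in>{1..n}. rate n b x i) > 0"
    using assms by (intro sum_pos) (auto simp: rate_def)
  then show ?thesis
    by (simp add: jprob_def flip: sum_divide_distrib)
qed

lemma jprob_pos:
  assumes "\<And>v. b v > 0" "n > 0"
  shows "jprob n b x j > 0"
  unfolding jprob_def using assms
  by (intro divide_pos_pos sum_pos) (auto simp: rate_def)

lemma pathprob_pos: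
  assumes "\<And>v. b v > 0" "n > 0"
  shows "pathprob n b x js > 0"
  using assms by (induction js arbitrary: x) (auto intro!: mult_pos_pos jprob_pos)

lemma hit_prob_nonneg:
  assumes "\<And>v. b v > 0" "n > 0"
  shows "hit_prob n b h k x \<ge> 0"
  unfolding hit_prob_def using pathprob_pos[of b n x] assms
  by (intro sum_nonneg) (auto intro: less_imp_le)

lemma walk_append: "walk n x (js @ js') = walk n (walk n x js) js'"
  by (induction js arbitrary: x) auto

lemma first_hits_target: "first_hits n h h k = (if k = 0 then {[]} else {})"
  by (auto simp: first_hits_def dest!: spec[of _ 0])

lemma hit_prob_target: "hit_prob n b h k h = (if k = 0 then 1 else 0)"
  by (simp add: hit_prob_def first_hits_target)

lemma sum_hit_prob_step:
  assumes "x \<noteq> h"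
  shows "(\<Sum>k<Suc K. hit_prob n b h k x) =
         (\<Sum>j\<in>{1..n}. jprob n b x j * (\<Sum>k<K. hit_prob n b h k (step n x j)))"
proof -
  have "first_hits n h x 0 = {}"
    using assms by (auto simp: first_hits_def)
  then have "hit_prob n b h 0 x = 0"
    by (simp add: hit_prob_def)
  moreover have "hit_prob n b h (Suc k) x =
      (\<Sum>j\<in>{1..n}. jprob n b x j * hit_prob n b h k (step n x j))" for k
    using sum_pathprob_Cons[where n=n and h=h and x=x and k=k and b=b]
    by (simp add: hit_prob_def first_hits_Suc[OF assms])
  ultimately have "(\<Sum>k<Suc K. hit_prob n b h k x) =
      (\<Sum>k<K. \<Sum>j\<in>{1..n}. jprob n b x j * hit_prob n b h k (step n x j))"
    by (simp add: sum.lessThan_Suc_shift del: sum.lessThan_Suc)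
  then show ?thesis
    unfolding sum_distrib_left by (subst sum.swap)
qed

text \<open>Optional stopping at the hitting time of \<open>h\<close>, truncated at
  \<open>K\<close>: the chain arrives at \<open>h\<close> with value \<open>F h\<close>, and
  elsewhere \<open>F\<close> is nonnegative. Induction on \<open>K\<close> by the first step
  replaces the martingale argument.\<close>

lemma sum_hit_prob_le_superharmonic:
  assumes b: "\<And>v. b v > 0" "n > 0"
    and F: "\<And>x. F x \<ge> 0"
    and super: "\<And>x. (\<Sum>j\<in>{1..n}. jprob n b x j * F (step n x j)) \<le> F x"
  shows "(\<Sum>k<K. hit_prob n b h k x) * F h \<le> F x"
proof (induction K arbitrary: x)
  case 0
  then show ?case using F by simp
next
  case (Suc K)
  show ?case
  proof (cases "x = h")
    case True
    then show ?thesis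
      by (simp add: hit_prob_target sum.lessThan_Suc_shift del: sum.lessThan_Suc)
  next
    case False
    have "(\<Sum>k<Suc K. hit_prob n b h k x) * F h =
      (\<Sum>j\<in>{1..n}. jprob n b x j * ((\<Sum>k<K. hit_prob n b h k (step n x j)) * F h))"
      by (simp add: sum_hit_prob_step[OF False] sum_distrib_right mult.assoc del: sum.lessThan_Suc)
    also have "\<dots> \<le> (\<Sum>j\<in>{1..n}. jprob n b x j * F (step n x j))"
      using jprob_pos[of b n x, OF b] by (intro sum_mono mult_left_mono Suc.IH) (auto intro: less_imp_le)
    also have "\<dots> \<le> F x" by (rule super)
    finally show ?thesis .
  qed
qed

lemma sum_hit_prob_le_1:
  assumes "\<And>v. b v > 0" "n > 0"
  shows "(\<Sum>k<K. hit_prob n b h k x) \<le> 1"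
proof -
  have "(\<Sum>j\<in>{1..n}. jprob n b y j * 1) \<le> 1" for y
    using sum_jprob[of b n y] assms by simp
  then have "(\<Sum>k<K. hit_prob n b h k x) * 1 \<le> 1"
    by (intro sum_hit_prob_le_superharmonic[where F = "\<lambda>_. 1"] assms) auto
  then show ?thesis by simp
qed

lemma sum_jprob_mult_le:
  assumes b: "\<And>v. b v > 0" "n > 0"
    and j: "j \<in> {1..n}" and u: "\<And>i. u i \<le> 1" and uj: "u j \<le> 1 - c"
  shows "(\<Sum>i\<in>{1..n}. jprob n b x i * u i) \<le> 1 - jprob n b x j * c"
proof -
  have p: "jprob n b x i \<ge> 0" for i
    using jprob_pos[of b n x i] b by (simp add: less_imp_le)
  have "(\<Sum>i\<in>{1..n}. jprob n b x i * u i) \<le>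
        (\<Sum>i\<in>{1..n}. jprob n b x i - (if i = j then jprob n b x j * c else 0))"
  proof (rule sum_mono)
    fix i
    show "jprob n b x i * u i \<le> jprob n b x i - (if i = j then jprob n b x j * c else 0)"
      using mult_left_mono[OF u[of i] p[of i]] mult_left_mono[OF uj p[of j]]
      by (auto simp: right_diff_distrib)
  qed
  also have "\<dots> = 1 - jprob n b x j * c"
    using j sum_jprob[of b n x] b by (simp add: sum_subtractf)
  finally show ?thesis .
qed

text \<open>With probability \<open>pathprob n b x js\<close> the chain follows \<open>js\<close>
  without meeting \<open>h\<close>; from the end of \<open>js\<close> it hits \<open>h\<close> with
  probability at most the ratio of the values of \<open>F\<close>. All other branches are bounded by
  1.\<close>

lemma sum_hit_prob_le_path:
  assumes b: "\<And>v. b v > 0" "n > 0"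
    and F: "\<And>x. F x > 0"
    and super: "\<And>x. (\<Sum>j\<in>{1..n}. jprob n b x j * F (step n x j)) \<le> F x"
    and js: "set js \<subseteq> {1..n}" "\<And>i. i \<le> length js \<Longrightarrow> walk n x (take i js) \<noteq> h"
  shows "(\<Sum>k<K. hit_prob n b h k x) \<le> 1 - pathprob n b x js * (1 - F (walk n x js) / F h)"
  using js
proof (induction js arbitrary: x K)
  case Nil
  have "(\<Sum>k<K. hit_prob n b h k x) * F h \<le> F x"
    using F by (intro sum_hit_prob_le_superharmonic b super) (auto intro: less_imp_le)
  then show ?case
    using F[of h] by (simp add: field_simps)
next
  case (Cons j js)
  have "x \<noteq> h"
    using Cons.prems(2)[of 0] by simp
  have "(\<Sum>k<K. hit_prob n b h k (step n x j)) \<le>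
        1 - pathprob n b (step n x j) js * (1 - F (walk n (step n x j) js) / F h)"
  proof (rule Cons.IH)
    show "walk n (step n x j) (take i js) \<noteq> h" if "i \<le> length js" for i
      using Cons.prems(2)[of "Suc i"] that by simp
  qed (use Cons.prems in auto)
  then have "(\<Sum>i\<in>{1..n}. jprob n b x i * (\<Sum>k<K. hit_prob n b h k (step n x i))) \<le>
      1 - jprob n b x j * (pathprob n b (step n x j) js * (1 - F (walk n (step n x j) js) / F h))"
    using Cons.prems(1) by (intro sum_jprob_mult_le b sum_hit_prob_le_1) auto
  \<comment> \<open>The extra summand makes the first-step identity, stated for
    \<open>Suc K\<close>, applicable.\<close>
  moreover have "(\<Sum>k<K. hit_prob n b h k x) \<le> (\<Sum>k<Suc K. hit_prob n b h k x)"
    using hit_prob_nonneg[of b n h K x] b by simp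
  ultimately show ?case
    by (simp add: sum_hit_prob_step[OF \<open>x \<noteq> h\<close>] mult.assoc del: sum.lessThan_Suc)
qed

text \<open>From \<open>h\<close> the chain can reach a point with a smaller value of
  \<open>F\<close> before returning, and from there it misses \<open>h\<close> with positive
  probability.\<close>

lemma return_prob_less_1:
  assumes b: "\<And>v. b v > 0" "n > 0"
    and F: "\<And>x. F x > 0"
    and super: "\<And>x. (\<Sum>j\<in>{1..n}. jprob n b x j * F (step n x j)) \<le> F x"
    and descent: "\<exists>js. set js \<subseteq> {1..n} \<and> F (walk n h js) < F h"
  shows "return_prob n b h < 1"
proof -
  define P where "P js \<longleftrightarrow> set js \<subseteq> {1..n} \<and> F (walk n h js) < F h" for js
  define js where "js = arg_min length P"
  obtain js0 where "P js0"
    using descent by (auto simp: P_def)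
  then have js: "P js" and minimal: "\<And>js'. P js' \<Longrightarrow> length js \<le> length js'"
    using arg_min_nat_lemma[of P js0 length] by (auto simp: js_def)
  from js obtain j js' where eq: "js = j # js'"
    by (cases js) (auto simp: P_def)
  \<comment> \<open>A shortest descending path does not revisit its starting point.\<close>
  have avoid: "walk n (step n h j) (take i js') \<noteq> h" if "i \<le> length js'" for i
  proof
    assume *: "walk n (step n h j) (take i js') = h"
    have "walk n h js = walk n (walk n h (take (Suc i) js)) (drop (Suc i) js)"
      by (simp flip: walk_append)
    with * js have "P (drop (Suc i) js)"
      using set_drop_subset[of "Suc i" js] by (auto simp: P_def eq)
    from minimal[OF this] show False
      by (simp add: eq)
  qed
  define c where "c = pathprob n b h js * (1 - F (walk n h js) / F h)"
  have "c > 0"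
    using js F[of h] pathprob_pos[of b n h js] b by (auto simp: c_def P_def)
  have "(\<Sum>k<K. \<Sum>js\<in>first_returns n h (Suc k). pathprob n b h js) \<le> 1 - c" for K
  proof -
    have "(\<Sum>k<K. hit_prob n b h k (step n h j)) \<le>
          1 - pathprob n b (step n h j) js' * (1 - F (walk n (step n h j) js') / F h)"
      using js avoid by (intro sum_hit_prob_le_path b F super) (auto simp: P_def eq)
    then have "(\<Sum>i\<in>{1..n}. jprob n b h i * (\<Sum>k<K. hit_prob n b h k (step n h i))) \<le>
        1 - jprob n b h j * (pathprob n b (step n h j) js' * (1 - F (walk n (step n h j) js') / F h))"
      using js by (intro sum_jprob_mult_le b sum_hit_prob_le_1) (auto simp: P_def eq)
    also have "\<dots> = 1 - c"
      by (simp add: c_def eq)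
    also have "(\<Sum>i\<in>{1..n}. jprob n b h i * (\<Sum>k<K. hit_prob n b h k (step n h i))) =
        (\<Sum>k<K. \<Sum>js\<in>first_returns n h (Suc k). pathprob n b h js)"
      unfolding first_returns_Suc sum_pathprob_Cons sum_distrib_left by (rule sum.swap)
    finally show ?thesis .
  qed
  moreover have "(\<Sum>js\<in>first_returns n h (Suc k). pathprob n b h js) \<ge> 0" for k
    using pathprob_pos[of b n] b by (intro sum_nonneg) (auto intro: less_imp_le)
  ultimately have "return_prob n b h \<le> ennreal (1 - c)"
    unfolding return_prob_def by (intro suminf_le_const summableI) (simp add: sum_ennreal ennreal_leI)
  also have "\<dots> < 1"
    using \<open>c > 0\<close> by (simp add: ennreal_less_one_iff)
  finally show ?thesis .
qed

section \<open>Drift of a single plateau\<close>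

text \<open>
  On an excited plateau the level anticipates the imminent fast rise of the minimum. The constants
  \<open>2/3 < 5/6 < 1\<close> of \<open>level3\<close> ensure that whenever some site jumps at rate \<open>\<beta>\<^sub>1\<close>, one such jump gains at least
  \<open>1/6\<close> and none loses, while the flat state gains at rate \<open>3 \<beta>\<^sub>0 2/3 = 2 \<beta>\<^sub>0\<close>. In the pit \<open>v < min u w\<close>, where no fast jump is available, the weight 2
  given to \<open>v\<close> yields a drift of at least \<open>2 \<beta>\<^sub>2 - \<beta>\<^sub>0\<close>.
\<close>

definition level2 :: "real \<Rightarrow> int \<Rightarrow> int \<Rightarrow> real" where
  "level2 a u v = min u v + (if u = v then 0 else 1 - a)"

definition level3 :: "int \<Rightarrow> int \<Rightarrow> int \<Rightarrow> real" where
  "level3 u v w = (if v < min u w then 2 * v - min u w else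
     min u w + (if u = v \<and> v = w then 0
                else if min u w < v \<and> min u w < max u w then 5 / 6 else 2 / 3))"

lemma level2_bounds: "0 \<le> a \<Longrightarrow> a \<le> 1 \<Longrightarrow> level2 a u v \<le> u + 1 \<and> level2 a u v \<le> v + 1"
  by (auto simp: level2_def min_def)

lemma level3_bounds: "level3 u v w \<le> u + 1 \<and> level3 u v w \<le> w + 1"
  by (auto simp: level3_def min_def)

lemma level2_shift: "level2 a (u + c) (v + c) = level2 a u v + c"
  by (auto simp: level2_def min_def)

lemma level3_shift: "level3 (u + c) (v + c) (w + c) = level3 u v w + c"
  by (auto simp: level3_def min_def max_def)

lemma level2_flat: "level2 a u u = u"
  by (simp add: level2_def)

lemma level3_flat: "level3 u u u = u"
  by (simp add: level3_def)

lemma level2_commute: "level2 a u v = level2 a v u"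
  by (auto simp: level2_def)

lemma level3_commute: "level3 u v w = level3 w v u"
  by (auto simp: level3_def min_def max_def)

lemma level2_jump:
  assumes "0 \<le> a" "a \<le> 1"
  shows "\<bar>level2 a (u + 1) v - level2 a u v\<bar> \<le> 3" "\<bar>level2 a u (v + 1) - level2 a u v\<bar> \<le> 3"
  using assms by (auto simp: level2_def min_def)

lemma level3_jump:
  "\<bar>level3 (u + 1) v w - level3 u v w\<bar> \<le> 3"
  "\<bar>level3 u (v + 1) w - level3 u v w\<bar> \<le> 3"
  "\<bar>level3 u v (w + 1) - level3 u v w\<bar> \<le> 3"
  by (auto simp: level3_def min_def max_def)

lemma exp_quadratic_bound:
  fixes u :: real
  assumes "\<bar>u\<bar> \<le> 1"
  shows "exp u \<le> 1 + u + u\<^sup>2"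
proof (cases "u \<ge> 0")
  case True
  then show ?thesis using exp_bound[of u] assms by auto
next
  case False
  \<comment> \<open>For negative \<open>u\<close> the reciprocal is estimated:
    \<open>exp (- u)\<close> is at least its quadratic Taylor polynomial, whose product with the
    claimed bound is at least 1.\<close>
  have "1 \<le> (1 + u + u\<^sup>2) * (1 - u + u\<^sup>2 / 2)"
  proof -
    have "(1 + u + u\<^sup>2) * (1 - u + u\<^sup>2 / 2) - 1 = u\<^sup>2 / 2 * (1 - u + u\<^sup>2)"
      by (simp add: field_simps power2_eq_square)
    moreover have "u\<^sup>2 / 2 * (1 - u + u\<^sup>2) \<ge> 0"
      using False by (intro mult_nonneg_nonneg add_nonneg_nonneg) auto
    ultimately show ?thesis by linarith
  qed
  also have "\<dots> \<le> (1 + u + u\<^sup>2) * exp (- u)"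
    using exp_lower_Taylor_quadratic[of "- u"] False assms
    by (intro mult_left_mono) auto
  finally show ?thesis
    by (simp add: exp_minus field_simps)
qed

lemma ex_list_with_counts:
  assumes "finite A"
  shows "\<exists>js. set js \<subseteq> A \<and> (\<forall>k\<in>A. count_list js k = m k)"
  using assms
proof (induction A rule: finite_induct)
  case empty
  show ?case by simp
next
  case (insert x A)
  then obtain js where js: "set js \<subseteq> A" "\<forall>k\<in>A. count_list js k = m k"
    by auto
  have "count_list (replicate l x) k = (if k = x then l else 0)" for l k
    by (induction l) auto
  moreover have "count_list js x = 0"
    using js insert.hyps by (auto simp: count_list_0_iff)
  ultimately show ?case
    using js insert.hyps by (intro exI[of _ "replicate (m x) x @ js"]) auto
qed

text \<open>The first summand yields \<open>b1 * alpha \<ge> 3 * b0\<close>. The second makes a gain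
  of 1/6 at rate \<open>b1\<close> worth at least \<open>5 * b0\<close>, enough for the target
  \<open>b2 + slack < 2 * b0\<close> plus a loss of 5/3 at rate \<open>b0\<close>.\<close>

definition crystal_bound :: "real \<Rightarrow> real \<Rightarrow> real" where
  "crystal_bound b0 b2 = 12 * b0\<^sup>2 / (2 * b0 - b2) + 30 * b0"

locale crystal =
  fixes b0 b1 b2 :: real and n :: nat
  assumes b0_pos: "0 < b0" and b0_less_b2: "b0 < b2" and b2_less: "b2 < 2 * b0"
    and b1_large: "crystal_bound b0 b2 < b1" and n_ge_5: "5 \<le> n"
begin

section \<open>Choice of the constants\<close>

abbreviation beta :: "nat \<Rightarrow> real" where
  "beta \<equiv> betaV b0 b1 b2"

text \<open>Chosen so that the flat plateau of width 2 has drift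
  \<open>2 * b0 * (1 - alpha) = b0 + b2 / 2\<close>, halfway between \<open>b2\<close> and
  \<open>2 * b0\<close>.\<close>

definition alpha :: real where "alpha = (2 * b0 - b2) / (4 * b0)"

text \<open>The first term is the surplus over \<open>b2\<close> of the flat plateau of width 2, the
  second that of a pit, \<open>2 * b2 - b0 - b2\<close>.\<close>

definition slack :: real where "slack = min (b0 - b2 / 2) (b2 - b0)"

text \<open>The 28 collects second-order terms in units of \<open>b1 * theta\<^sup>2\<close>: at
  most three plateau sites with squared jumps at most 9, and one for the hole. This
  \<open>theta\<close> makes them balance the gain \<open>theta * slack\<close>.\<close>

definition theta :: real where "theta = slack / (28 * b1)"

lemma b1_ge: "30 * b0 \<le> b1"
proof -
  have "12 * b0\<^sup>2 / (2 * b0 - b2) \<ge> 0"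
    using b2_less by simp
  then show ?thesis using b1_large by (simp add: crystal_bound_def)
qed

lemma alpha_bounds: "0 < alpha" "alpha < 1"
  using b0_pos b2_less b0_less_b2 by (auto simp: alpha_def field_simps)

lemma b1_alpha_ge: "3 * b0 \<le> b1 * alpha"
proof -
  have "12 * b0\<^sup>2 / (2 * b0 - b2) \<le> b1"
    using b1_large b0_pos by (simp add: crystal_bound_def)
  then have "12 * b0\<^sup>2 / (2 * b0 - b2) * alpha \<le> b1 * alpha"
    using alpha_bounds by (intro mult_right_mono) auto
  also have "12 * b0\<^sup>2 / (2 * b0 - b2) * alpha = 3 * b0"
    using b0_pos b2_less by (simp add: alpha_def field_simps power2_eq_square)
  finally show ?thesis .
qed

lemma slack_bounds: "0 < slack" "slack \<le> b0 - b2 / 2" "slack \<le> b2 - b0"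
  using b0_less_b2 b2_less by (auto simp: slack_def)

lemma b1_pos: "0 < b1"
  using b1_ge b0_pos by linarith

lemma theta_bounds: "0 < theta" "theta \<le> 1 / 3"
  using slack_bounds b1_pos b1_ge b0_less_b2 b0_pos by (auto simp: theta_def field_simps)

lemma beta_bounds: "0 < beta v" "beta v \<le> b1"
  using b0_pos b0_less_b2 b2_less b1_ge by (auto simp: betaV_def)

text \<open>Only neighbours inside the plateau enter the rates, because adjacent holes are lower. At
  height difference 1 the lower site gains \<open>alpha\<close> at rate \<open>b1\<close>, at a
  larger difference a full unit.\<close>

lemma level2_drift:
  "b2 + slack \<le> beta (of_bool (v > u)) * (level2 alpha (u + 1) v - level2 alpha u v)
              + beta (of_bool (u > v)) * (level2 alpha u (v + 1) - level2 alpha u v)"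
proof -
  have *: "b2 + slack \<le> beta (of_bool (v > u)) * (level2 alpha (u + 1) v - level2 alpha u v)
              + beta (of_bool (u > v)) * (level2 alpha u (v + 1) - level2 alpha u v)" if le: "v \<le> u" for u v
  proof -
    consider "u = v" | "u = v + 1" | "u > v + 1" using le by linarith
    then show ?thesis
    proof cases
      case 1
      have "b0 * alpha = (2 * b0 - b2) / 4"
        using b0_pos by (simp add: alpha_def)
      then show ?thesis
        using 1 slack_bounds b0_pos by (simp add: level2_def betaV_def algebra_simps)
    next
      case 2
      then show ?thesis
        using slack_bounds b1_alpha_ge b0_pos by (simp add: level2_def betaV_def algebra_simps)
    next
      case 3
      then show ?thesis
        using slack_bounds b1_ge b0_pos by (simp add: level2_def betaV_def algebra_simps)
    qed
  qed
  show ?thesis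
  proof (cases "v \<le> u")
    case False
    then have "u \<le> v" by simp
    from *[OF this] show ?thesis
      unfolding level2_commute[of alpha "v + 1" u] level2_commute[of alpha v "u + 1"]
        level2_commute[of alpha v u]
      by (simp only: add_ac)
  qed (rule *)
qed

text \<open>Outside the flat state and the pit, some jump at rate \<open>b1\<close> gains at least
  1/6. The only loss there is 5/3 at rate \<open>b0\<close>, when in the case \<open>slope\<close>
  the edge site \<open>w\<close> jumps and opens a pit. By mirror symmetry \<open>w \<le> u\<close>
  may be assumed.\<close>

lemma level3_drift:
  "b2 + slack \<le> beta (of_bool (v > u)) * (level3 (u + 1) v w - level3 u v w)
              + beta (of_bool (u > v) + of_bool (w > v)) * (level3 u (v + 1) w - level3 u v w)
              + beta (of_bool (v > w)) * (level3 u v (w + 1) - level3 u v w)"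
proof -
  have *: "b2 + slack \<le> beta (of_bool (v > u)) * (level3 (u + 1) v w - level3 u v w)
              + beta (of_bool (u > v) + of_bool (w > v)) * (level3 u (v + 1) w - level3 u v w)
              + beta (of_bool (v > w)) * (level3 u v (w + 1) - level3 u v w)"
    if le: "w \<le> u" for u v w
  proof -
    consider (hole) "v < w" | (flat) "v = w" "u = w" | (slope) "v = w" "u > w"
      | (peak) "v > w" "u = w" | (high) "v > w" "u > w"
      using le by linarith
    then show ?thesis
    proof cases
      case hole
      \<comment> \<open>The split decides whether the next jump of \<open>v\<close> closes the pit
        and how a jump of a wall changes \<open>min u w\<close>.\<close>
      then have "w = v + 1 \<or> v < w - 1" "u = w \<or> u = w + 1 \<or> u > w + 1"
        using le by linarith+
      then show ?thesis
        using slack_bounds b0_less_b2 b2_less b0_pos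
        by (elim disjE) (simp_all add: level3_def betaV_def algebra_simps)
    next
      case flat
      then show ?thesis
        using slack_bounds b0_less_b2 b2_less b0_pos
        by (simp add: level3_def betaV_def)
    next
      case slope
      then have "u = w + 1 \<or> u > w + 1" by linarith
      then show ?thesis
        using slope slack_bounds b0_less_b2 b2_less b0_pos b1_ge
        by (elim disjE) (simp_all add: level3_def betaV_def algebra_simps)
    next
      case peak
      then have "v = w + 1 \<or> v > w + 1" by linarith
      then show ?thesis
        using peak slack_bounds b0_less_b2 b2_less b0_pos b1_ge
        by (elim disjE) (simp_all add: level3_def betaV_def algebra_simps)
    next
      case high
      then have eq: "level3 (u + 1) v w = level3 u v w" "level3 u (v + 1) w = level3 u v w"
        by (simp_all add: level3_def)
      have "level3 u v w = w + 5 / 6" "level3 u v (w + 1) \<ge> w + 1"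
        using high by (auto simp: level3_def min_def)
      then have "b1 * (1 / 6) \<le> b1 * (level3 u v (w + 1) - level3 u v w)"
        using b1_pos by (intro mult_left_mono) auto
      moreover have "b2 + slack \<le> b1 * (1 / 6)"
        using slack_bounds b2_less b0_pos b1_ge by linarith
      ultimately have "b2 + slack \<le> b1 * (level3 u v (w + 1) - level3 u v w)"
        by (rule order_trans[rotated])
      then show ?thesis
        using eq high by (simp add: betaV_def)
    qed
  qed
  show ?thesis
  proof (cases "w \<le> u")
    case False
    then have "u \<le> w" by simp
    from *[OF this, of v] show ?thesis
      unfolding level3_commute[of "w + 1" v u] level3_commute[of w "v + 1" u]
        level3_commute[of w v "u + 1"] level3_commute[of w v u]
      by (simp only: add_ac)
  qed (rule *)
qed


section \<open>The superharmonic function\<close>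

text \<open>
  Write \<open>n + 1 = 3 m + r\<close> with \<open>r < 3\<close>. The first \<open>r\<close> plateaus have width 3, the others width 2, and
  plateau \<open>k < m\<close> lies strictly between \<open>hole k\<close> and \<open>hole (Suc k)\<close>; the indices \<open>0\<close> and
  \<open>m\<close> give the fictitious boundary sites \<open>0\<close> and \<open>n + 1\<close>.
\<close>

definition hole :: "nat \<Rightarrow> nat" where
  "hole i = 3 * i + min i (Suc n mod 3)"

definition plateaus :: nat where
  "plateaus = Suc n div 3"

definition level :: "(nat \<Rightarrow> int) \<Rightarrow> nat \<Rightarrow> real" where
  "level x k = (if k < Suc n mod 3
     then level3 (x (hole k + 1)) (x (hole k + 2)) (x (hole k + 3))
     else level2 alpha (x (hole k + 1)) (x (hole k + 2)))"

definition sides :: "(nat \<times> nat) set" where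
  "sides = {(i, k). 1 \<le> i \<and> i < plateaus \<and> (k = i \<or> Suc k = i)}"

text \<open>The \<open>1 +\<close> absorbs the excess of a level over the edge sites of its plateau,
  so that \<open>potential x < 1\<close> puts every hole strictly below both neighbours.\<close>

definition potential :: "(nat \<Rightarrow> int) \<Rightarrow> real" where
  "potential x = (\<Sum>(i, k)\<in>sides. exp (theta * (1 + real_of_int (x (hole i)) - level x k)))"

text \<open>Boundary sites never count, since crystal heights are nonnegative. The guards express
  this without reference to the height 0, so the count is also right for shifted, possibly negative
  heights.\<close>

definition higher :: "(nat \<Rightarrow> int) \<Rightarrow> nat \<Rightarrow> nat" where
  "higher x j = of_bool (2 \<le> j \<and> x (j - 1) > x j) + of_bool (j + 1 \<le> n \<and> x (j + 1) > x j)"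

abbreviation bump :: "(nat \<Rightarrow> int) \<Rightarrow> nat \<Rightarrow> (nat \<Rightarrow> int)" where
  "bump x j \<equiv> x(j := x j + 1)"

section \<open>Positions of holes and plateaus\<close>

lemma hole_0: "hole 0 = 0"
  by (simp add: hole_def)

lemma hole_Suc: "hole (Suc k) = hole k + (if k < Suc n mod 3 then 4 else 3)"
  by (auto simp: hole_def)

text \<open>Here \<open>n \<ge> 5\<close> enters: there is room for up to two plateaus of width 3,
  and at least one genuine hole exists.\<close>

lemma plateaus_ge_2: "2 \<le> plateaus"
  using n_ge_5 by (simp add: plateaus_def)

lemma hole_plateaus: "hole plateaus = Suc n"
proof -
  have "Suc n mod 3 \<le> plateaus"
    using plateaus_ge_2 mod_less_divisor[of 3 "Suc n"] by linarith
  then show ?thesis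
    unfolding hole_def plateaus_def by (simp add: min_absorb2)
qed

lemma hole_strict_mono: "i < k \<Longrightarrow> hole i < hole k"
  by (auto simp: hole_def)

lemma hole_mono: "i \<le> k \<Longrightarrow> hole i \<le> hole k"
  by (auto simp: hole_def)

lemma hole_le: "i < plateaus \<Longrightarrow> hole (Suc i) \<le> Suc n"
  using hole_mono[of "Suc i" plateaus] by (simp add: hole_plateaus)

lemma finite_sides: "finite sides"
  by (rule finite_subset[of _ "{..plateaus} \<times> {..plateaus}"]) (auto simp: sides_def)

text \<open>\<open>S\<close> is a plateau, \<open>p\<close> a hole and \<open>L\<close> the level.
  To first order in \<open>theta\<close> the hole contributes \<open>b2\<close> and the plateau at
  most \<open>- (b2 + slack)\<close>; the quadratic remainder is absorbed by the choice of
  \<open>theta\<close>.\<close>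

lemma exp_drift:
  fixes L :: "(nat \<Rightarrow> int) \<Rightarrow> real"
  assumes S: "S \<subseteq> {1..n}" "card S \<le> 3" and p: "p \<in> {1..n}" "p \<notin> S"
    and local: "\<And>j. j \<notin> S \<Longrightarrow> L (bump x j) = L x"
    and jump: "\<And>j. j \<in> S \<Longrightarrow> \<bar>L (bump x j) - L x\<bar> \<le> 3"
    and r: "\<And>j. 0 \<le> r j" "\<And>j. r j \<le> b1" "r p = b2"
    and drift: "b2 + slack \<le> (\<Sum>j\<in>S. r j * (L (bump x j) - L x))"
  shows "(\<Sum>j\<in>{1..n}. r j * (exp (theta * (1 + real_of_int (bump x j p) - L (bump x j)))
                             - exp (theta * (1 + real_of_int (x p) - L x)))) \<le> 0"
proof -
  define E where "E = exp (theta * (1 + real_of_int (x p) - L x))"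
  define D where "D j = L (bump x j) - L x" for j
  have finS: "finite S"
    using S(1) finite_subset by blast
  have "exp (theta * (1 + real_of_int (bump x j p) - L (bump x j))) =
        E * exp (theta * ((if j = p then 1 else 0) - D j))" for j
    by (auto simp: E_def D_def algebra_simps simp flip: exp_add)
  then have "(\<Sum>j\<in>{1..n}. r j * (exp (theta * (1 + real_of_int (bump x j p) - L (bump x j)))
                             - exp (theta * (1 + real_of_int (x p) - L x)))) =
        (\<Sum>j\<in>{1..n}. E * (r j * (exp (theta * ((if j = p then 1 else 0) - D j)) - 1)))"
    by (simp add: E_def algebra_simps)
  also have "\<dots> = (\<Sum>j\<in>insert p S. E * (r j * (exp (theta * ((if j = p then 1 else 0) - D j)) - 1)))"
    using S p local by (intro sum.mono_neutral_right) (auto simp: D_def)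
  also have "\<dots> = E * (b2 * (exp theta - 1)
      + (\<Sum>j\<in>S. r j * (exp (theta * ((if j = p then 1 else 0) - D j)) - 1)))"
    using finS p(2) local[of p] r(3) by (simp add: D_def sum_distrib_left distrib_left)
  also have "(\<Sum>j\<in>S. r j * (exp (theta * ((if j = p then 1 else 0) - D j)) - 1)) =
      (\<Sum>j\<in>S. r j * (exp (- (theta * D j)) - 1))"
    using p(2) by (intro sum.cong) auto
  also have "E * (b2 * (exp theta - 1) + (\<Sum>j\<in>S. r j * (exp (- (theta * D j)) - 1))) \<le> 0"
  proof (rule mult_nonneg_nonpos)
    have "b2 * (exp theta - 1) \<le> b2 * (theta + theta\<^sup>2)"
      using exp_quadratic_bound[of theta] theta_bounds b0_pos b0_less_b2
      by (intro mult_left_mono) auto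
    also have "\<dots> \<le> b2 * theta + b1 * theta\<^sup>2"
      using b1_ge b2_less b0_pos by (simp add: distrib_left mult_right_mono)
    finally have 1: "b2 * (exp theta - 1) \<le> b2 * theta + b1 * theta\<^sup>2" .
    have "(\<Sum>j\<in>S. r j * (exp (- (theta * D j)) - 1)) \<le>
          (\<Sum>j\<in>S. 9 * b1 * theta\<^sup>2 - theta * (r j * D j))"
    proof (rule sum_mono)
      fix j assume "j \<in> S"
      have D: "\<bar>theta * D j\<bar> \<le> theta * 3"
        using jump[OF \<open>j \<in> S\<close>] theta_bounds by (simp add: abs_mult D_def)
      have "(theta * D j)\<^sup>2 \<le> (theta * 3)\<^sup>2"
        using D theta_bounds by (intro power2_le_iff_abs_le[THEN iffD2]) auto
      moreover have "exp (- (theta * D j)) \<le> 1 + - (theta * D j) + (- (theta * D j))\<^sup>2"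
        using D theta_bounds by (intro exp_quadratic_bound) auto
      ultimately have "exp (- (theta * D j)) - 1 \<le> 9 * theta\<^sup>2 - theta * D j"
        by (simp add: power_mult_distrib)
      then have "r j * (exp (- (theta * D j)) - 1) \<le> r j * (9 * theta\<^sup>2 - theta * D j)"
        using r by (intro mult_left_mono) auto
      also have "\<dots> = r j * (9 * theta\<^sup>2) - theta * (r j * D j)"
        by (simp add: algebra_simps)
      also have "r j * (9 * theta\<^sup>2) \<le> b1 * (9 * theta\<^sup>2)"
        using r by (intro mult_right_mono) auto
      finally show "r j * (exp (- (theta * D j)) - 1) \<le> 9 * b1 * theta\<^sup>2 - theta * (r j * D j)"
        by simp
    qed
    also have "\<dots> = card S * (9 * b1 * theta\<^sup>2) - theta * (\<Sum>j\<in>S. r j * D j)"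
      by (simp add: sum_subtractf sum_distrib_left)
    also have "\<dots> \<le> 3 * (9 * b1 * theta\<^sup>2) - theta * (b2 + slack)"
      using S(2) drift theta_bounds b1_pos
      by (intro diff_mono mult_right_mono mult_left_mono) (auto simp: D_def)
    finally have "b2 * (exp theta - 1) + (\<Sum>j\<in>S. r j * (exp (- (theta * D j)) - 1)) \<le>
        theta * (28 * b1 * theta - slack)"
      using 1 by (simp add: algebra_simps power2_eq_square)
    also have "28 * b1 * theta - slack = 0"
      using b1_pos by (simp add: theta_def)
    finally show "b2 * (exp theta - 1) + (\<Sum>j\<in>S. r j * (exp (- (theta * D j)) - 1)) \<le> 0"
      by simp
  qed (simp add: E_def)
  finally show ?thesis .
qed

section \<open>Superharmonicity of the potential\<close>

lemma level_bump_outside: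
  assumes "j \<notin> {hole k<..<hole (Suc k)}"
  shows "level (bump x j) k = level x k"
  using assms by (auto simp: level_def hole_Suc split: if_splits)

lemma level_jump: "\<bar>level (bump x j) k - level x k\<bar> \<le> 3"
proof (cases "j \<in> {hole k<..<hole (Suc k)}")
  case True
  then have "j = hole k + 1 \<or> j = hole k + 2 \<or> (j = hole k + 3 \<and> k < Suc n mod 3)"
    by (auto simp: hole_Suc split: if_splits)
  then show ?thesis
    using level3_jump level2_jump[of alpha] alpha_bounds by (auto simp: level_def)
qed (simp add: level_bump_outside)

text \<open>The outermost plateaus border on fictitious sites, which \<open>higher\<close> ignores;
  hence the conditions on the holes are guarded.\<close>

lemma level_drift:
  assumes k: "k < plateaus"
    and left: "k \<noteq> 0 \<Longrightarrow> x (hole k) < x (Suc (hole k))"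
    and right: "Suc k \<noteq> plateaus \<Longrightarrow> x (hole (Suc k)) < x (hole (Suc k) - 1)"
  shows "b2 + slack \<le>
    (\<Sum>j\<in>{hole k<..<hole (Suc k)}. beta (higher x j) * (level (bump x j) k - level x k))"
proof -
  have left': "\<not> (2 \<le> Suc (hole k) \<and> x (hole k) > x (Suc (hole k)))"
    using left hole_0 by (cases "k = 0") auto
  have right': "\<not> (hole (Suc k) \<le> n \<and> x (hole (Suc k)) > x (hole (Suc k) - 1))"
    using right hole_plateaus by (cases "Suc k = plateaus") auto
  have le: "hole (Suc k) \<le> Suc n"
    using k by (rule hole_le)
  show ?thesis
  proof (cases "k < Suc n mod 3")
    case True
    define s where "s = hole k"
    have s: "hole (Suc k) = s + 4"
      using True by (simp add: hole_Suc s_def)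
    have "{hole k<..<hole (Suc k)} = {s + 1, s + 2, s + 3}"
      by (auto simp: s s_def)
    then have sum: "sum f {hole k<..<hole (Suc k)} = f (s + 1) + f (s + 2) + f (s + 3)"
      for f :: "nat \<Rightarrow> real"
      by (simp add: add.assoc)
    have higher:
      "higher x (s + 1) = of_bool (x (s + 2) > x (s + 1))"
      "higher x (s + 2) = of_bool (x (s + 1) > x (s + 2)) + of_bool (x (s + 3) > x (s + 2))"
      "higher x (s + 3) = of_bool (x (s + 2) > x (s + 3))"
      using left' right' le s by (auto simp: higher_def s_def numeral_eq_Suc)
    have level:
      "level x k = level3 (x (s + 1)) (x (s + 2)) (x (s + 3))"
      "level (bump x (s + 1)) k = level3 (x (s + 1) + 1) (x (s + 2)) (x (s + 3))"
      "level (bump x (s + 2)) k = level3 (x (s + 1)) (x (s + 2) + 1) (x (s + 3))"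
      "level (bump x (s + 3)) k = level3 (x (s + 1)) (x (s + 2)) (x (s + 3) + 1)"
      using True by (simp_all add: level_def s_def)
    show ?thesis
      unfolding sum higher level by (rule level3_drift)
  next
    case False
    define s where "s = hole k"
    have s: "hole (Suc k) = s + 3"
      using False by (simp add: hole_Suc s_def)
    have "{hole k<..<hole (Suc k)} = {s + 1, s + 2}"
      by (auto simp: s s_def)
    then have sum: "sum f {hole k<..<hole (Suc k)} = f (s + 1) + f (s + 2)"
      for f :: "nat \<Rightarrow> real"
      by simp
    have higher:
      "higher x (s + 1) = of_bool (x (s + 2) > x (s + 1))"
      "higher x (s + 2) = of_bool (x (s + 1) > x (s + 2))"
      using left' right' le s by (auto simp: higher_def s_def numeral_eq_Suc)
    have level:
      "level x k = level2 alpha (x (s + 1)) (x (s + 2))"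
      "level (bump x (s + 1)) k = level2 alpha (x (s + 1) + 1) (x (s + 2))"
      "level (bump x (s + 2)) k = level2 alpha (x (s + 1)) (x (s + 2) + 1)"
      using False by (simp_all add: level_def s_def)
    show ?thesis
      unfolding sum higher level by (rule level2_drift)
  qed
qed

lemma level_le_edges:
  "level x k \<le> x (Suc (hole k)) + 1" "level x k \<le> x (hole (Suc k) - 1) + 1"
  using level2_bounds[of alpha "x (hole k + 1)" "x (hole k + 2)"] alpha_bounds
    level3_bounds[of "x (hole k + 1)" "x (hole k + 2)" "x (hole k + 3)"]
  by (simp_all add: level_def hole_Suc add.commute)

lemma hole_below_plateau:
  assumes "potential x < 1" "(i, k) \<in> sides"
  shows "x (hole i) + 1 < level x k"
proof -
  have "exp (theta * (1 + real_of_int (x (hole i)) - level x k)) \<le> potential x"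
    using member_le_sum[of "(i, k)" sides "\<lambda>(i, k). exp (theta * (1 + real_of_int (x (hole i)) - level x k))"]
      assms(2) finite_sides by (simp add: potential_def case_prod_unfold)
  then have "exp (theta * (1 + real_of_int (x (hole i)) - level x k)) < exp 0"
    using assms(1) by (simp only: exp_zero)
  then show ?thesis
    using theta_bounds by (simp only: exp_less_cancel_iff) (simp add: mult_less_0_iff)
qed

text \<open>By linearity each pair of a hole and a plateau is treated alone, although pairs share
  sites. All holes being low, every hole has rate \<open>b2\<close> and every plateau evolves as if
  isolated.\<close>

lemma potential_superharmonic:
  assumes "potential x < 1"
  shows "(\<Sum>j\<in>{1..n}. beta (higher x j) * (potential (bump x j) - potential x)) \<le> 0"
proof -
  have below_right: "x (hole i) < x (Suc (hole i))" if "1 \<le> i" "i < plateaus" for i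
    using hole_below_plateau[OF assms, of i i] level_le_edges(1)[of x i] that
    by (simp add: sides_def)
  have below_left: "x (hole i) < x (hole i - 1)" if "1 \<le> i" "i < plateaus" for i
    using hole_below_plateau[OF assms, of i "i - 1"] level_le_edges(2)[of x "i - 1"] that
    by (simp add: sides_def)
  have "(\<Sum>j\<in>{1..n}. beta (higher x j) * (potential (bump x j) - potential x)) =
    (\<Sum>(i, k)\<in>sides. \<Sum>j\<in>{1..n}. beta (higher x j) *
      (exp (theta * (1 + real_of_int (bump x j (hole i)) - level (bump x j) k))
       - exp (theta * (1 + real_of_int (x (hole i)) - level x k))))"
    unfolding potential_def sum_subtractf[symmetric] sum_distrib_left
    by (subst sum.swap) (simp add: case_prod_unfold)
  also have "\<dots> \<le> 0"
  proof (rule sum_nonpos, clarify)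
    fix i k assume ik: "(i, k) \<in> sides"
    then have i: "1 \<le> i" "i < plateaus" and k: "k < plateaus"
      by (auto simp: sides_def)
    have hi: "2 \<le> hole i" "hole i \<le> n"
      using hole_strict_mono[of i plateaus] i by (simp_all add: hole_plateaus) (simp add: hole_def)
    have hn: "hole i + 1 \<le> n"
      using hole_le[OF i(2)] by (simp add: hole_Suc split: if_splits)
    show "(\<Sum>j\<in>{1..n}. beta (higher x j) *
      (exp (theta * (1 + real_of_int (bump x j (hole i)) - level (bump x j) k))
       - exp (theta * (1 + real_of_int (x (hole i)) - level x k)))) \<le> 0"
    proof (rule exp_drift[where S = "{hole k<..<hole (Suc k)}"])
      show "{hole k<..<hole (Suc k)} \<subseteq> {1..n}"
        using hole_le[OF k] by auto
      show "card {hole k<..<hole (Suc k)} \<le> 3"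
        by (auto simp: hole_Suc)
      show "hole i \<notin> {hole k<..<hole (Suc k)}"
        using ik by (auto simp: sides_def)
      have "higher x (hole i) = 2"
        using below_left[OF i] below_right[OF i] hi hn by (simp add: higher_def)
      then show "beta (higher x (hole i)) = b2"
        by (simp add: betaV_def)
      show "b2 + slack \<le> (\<Sum>j\<in>{hole k<..<hole (Suc k)}.
          beta (higher x j) * (level (bump x j) k - level x k))"
        using k below_right[of k] below_left[of "Suc k"] by (intro level_drift) auto
    qed (use hi beta_bounds in \<open>auto simp: level_jump level_bump_outside less_imp_le simp del: fun_upd_apply\<close>)
  qed
  finally show ?thesis .
qed

section \<open>Heights recovered from shapes\<close>

text \<open>
  Normalised to height 0 at site 1, so a jump of site 1 lowers all other sites instead; the
  potential is invariant under such shifts.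
\<close>

definition height :: "(nat \<Rightarrow> int) \<Rightarrow> nat \<Rightarrow> int" where
  "height h j = - (\<Sum>i\<in>{1..<j}. h i)"

definition lyapunov :: "(nat \<Rightarrow> int) \<Rightarrow> real" where
  "lyapunov h = min 1 (potential (height h))"

lemma height_Suc: "1 \<le> j \<Longrightarrow> height h (Suc j) = height h j - h j"
  by (simp add: height_def)

lemma step_apply:
  "step n h j i = h i - of_bool (2 \<le> j \<and> i = j - 1) + of_bool (j + 1 \<le> n \<and> i = j)"
  by (auto simp: step_def Let_def)

lemma height_step:
  assumes "j \<in> {1..n}" "k \<in> {1..n}"
  shows "height (step n h j) k = bump (height h) j k - of_bool (j = 1)"
proof -
  have "(\<Sum>i\<in>{1..<k}. of_bool (2 \<le> j \<and> i = j - 1)) = (of_bool (2 \<le> j \<and> j - 1 < k) :: int)"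
    by (cases "2 \<le> j") (auto simp: of_bool_def sum.If_cases)
  moreover have "(\<Sum>i\<in>{1..<k}. of_bool (j + 1 \<le> n \<and> i = j)) = (of_bool (j + 1 \<le> n \<and> j < k) :: int)"
    using assms by (cases "j + 1 \<le> n") (auto simp: of_bool_def)
  ultimately show ?thesis
    using assms by (auto simp: height_def step_apply sum.distrib sum_subtractf)
qed

lemma Vsh_height:
  assumes "j \<in> {1..n}"
  shows "Vsh n h j = higher (height h) j"
proof -
  have "2 \<le> j \<Longrightarrow> height h j = height h (j - 1) - h (j - 1)"
    using height_Suc[of "j - 1" h] by simp
  then show ?thesis
    using assms height_Suc[of j h] by (auto simp: Vsh_def higher_def)
qed

lemma level_cong_shift:
  assumes "\<And>j. j \<in> {1..n} \<Longrightarrow> y j = x j + c" "k < plateaus"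
  shows "level y k = level x k + c"
  using assms(1)[of "hole k + 1"] assms(1)[of "hole k + 2"] assms(1)[of "hole k + 3"]
    hole_le[OF assms(2)]
  by (simp add: level_def hole_Suc level2_shift level3_shift split: if_splits)

lemma hole_in_range: "1 \<le> i \<Longrightarrow> i < plateaus \<Longrightarrow> hole i \<in> {1..n}"
  using hole_strict_mono[of 0 i] hole_strict_mono[of i plateaus]
  by (simp add: hole_0 hole_plateaus)

lemma potential_cong_shift:
  assumes "\<And>j. j \<in> {1..n} \<Longrightarrow> y j = x j + c"
  shows "potential y = potential x"
  unfolding potential_def
proof (rule sum.cong[OF refl])
  fix ik assume "ik \<in> sides"
  then obtain i k where ik: "ik = (i, k)" and "(i, k) \<in> sides"
    by (cases ik) auto
  then have "y (hole i) = x (hole i) + c" "level y k = level x k + c"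
    using level_cong_shift[OF assms, where k = k] assms[OF hole_in_range, of i]
    by (auto simp: sides_def)
  then show "(case ik of (i, k) \<Rightarrow> exp (theta * (1 + real_of_int (y (hole i)) - level y k))) =
             (case ik of (i, k) \<Rightarrow> exp (theta * (1 + real_of_int (x (hole i)) - level x k)))"
    by (simp add: ik)
qed

lemma potential_pos: "0 < potential x"
proof -
  have "(1, 1) \<in> sides"
    using plateaus_ge_2 by (simp add: sides_def)
  then show ?thesis
    unfolding potential_def using finite_sides by (intro sum_pos) auto
qed

lemma lyapunov_pos: "0 < lyapunov h"
  using potential_pos by (simp add: lyapunov_def)

lemma lyapunov_step:
  assumes "j \<in> {1..n}"
  shows "lyapunov (step n h j) = min 1 (potential (bump (height h) j))"
  unfolding lyapunov_def
  using potential_cong_shift[of "height (step n h j)" "bump (height h) j" "- of_bool (j = 1)"]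
    height_step[OF assms]
  by simp

text \<open>Where the potential is below 1, the cap only lowers the values after a jump; elsewhere
  \<open>lyapunov\<close> already has its maximal value 1.\<close>

lemma lyapunov_superharmonic:
  "(\<Sum>j\<in>{1..n}. jprob n beta h j * lyapunov (step n h j)) \<le> lyapunov h"
proof -
  have drift: "(\<Sum>j\<in>{1..n}. rate n beta h j * (lyapunov (step n h j) - lyapunov h)) \<le> 0"
  proof (cases "potential (height h) < 1")
    case True
    have "(\<Sum>j\<in>{1..n}. rate n beta h j * (lyapunov (step n h j) - lyapunov h)) \<le>
      (\<Sum>j\<in>{1..n}. beta (higher (height h) j) * (potential (bump (height h) j) - potential (height h)))"
    proof (rule sum_mono)
      fix j assume "j \<in> {1..n}"
      then show "rate n beta h j * (lyapunov (step n h j) - lyapunov h) \<le>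
        beta (higher (height h) j) * (potential (bump (height h) j) - potential (height h))"
        using True beta_bounds(1)
        by (simp only: rate_def Vsh_height lyapunov_step) (simp add: lyapunov_def)
    qed
    also have "\<dots> \<le> 0"
      using True by (rule potential_superharmonic)
    finally show ?thesis .
  next
    case False
    then have "lyapunov h = 1" by (simp add: lyapunov_def)
    then show ?thesis
      using beta_bounds(1)
      by (intro sum_nonpos mult_nonneg_nonpos) (auto simp: rate_def lyapunov_def less_imp_le)
  qed
  have R: "(\<Sum>j\<in>{1..n}. rate n beta h j) > 0"
    using beta_bounds(1) n_ge_5 by (intro sum_pos) (auto simp: rate_def)
  have "(\<Sum>j\<in>{1..n}. jprob n beta h j * lyapunov (step n h j)) =
        (\<Sum>j\<in>{1..n}. rate n beta h j * lyapunov (step n h j)) / (\<Sum>j\<in>{1..n}. rate n beta h j)"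
    by (simp add: jprob_def sum_divide_distrib)
  also have "\<dots> \<le> lyapunov h"
    using drift R by (simp add: right_diff_distrib sum_subtractf divide_le_eq sum_distrib_left mult.commute)
  finally show ?thesis .
qed

section \<open>Paths that lower the superharmonic function\<close>

lemma height_walk:
  assumes "set js \<subseteq> {1..n}"
  shows "\<exists>c. \<forall>k\<in>{1..n}. height (walk n h js) k = height h k + int (count_list js k) + c"
  using assms
proof (induction js arbitrary: h)
  case Nil
  show ?case by (auto intro: exI[of _ 0])
next
  case (Cons j js)
  then have "set js \<subseteq> {1..n}" by simp
  from Cons.IH[OF this, of "step n h j"] obtain c where
    "\<forall>k\<in>{1..n}. height (walk n (step n h j) js) k =
      height (step n h j) k + int (count_list js k) + c" ..
  then have "\<forall>k\<in>{1..n}. height (walk n h (j # js)) k =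
      height h k + int (count_list (j # js) k) + (c - of_bool (j = 1))"
    using height_step[of j] Cons.prems by auto
  then show ?case ..
qed

text \<open>With the holes kept and all other sites at height \<open>K\<close>, every plateau is
  flat of level \<open>K\<close>, so each summand decays like
  \<open>exp (- theta) ^ K\<close>.\<close>

lemma potential_raised_tendsto_0:
  "(\<lambda>K::nat. potential (\<lambda>j. if j \<in> hole ` UNIV then x j else int K)) \<longlonglongrightarrow> 0"
proof -
  have not_hole: "j \<notin> range hole" if "hole k < j" "j < hole (Suc k)" for j k
  proof
    assume "j \<in> range hole"
    then obtain i where "j = hole i" by auto
    then show False
      using that hole_mono[of i k] hole_mono[of "Suc k" i] by (cases "i \<le> k") auto
  qed
  have "level (\<lambda>j. if j \<in> range hole then x j else int K) k = K" for K k
    using not_hole[of k "hole k + 1"] not_hole[of k "hole k + 2"] not_hole[of k "hole k + 3"]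
    by (simp add: level_def hole_Suc level2_flat level3_flat)
  then have eq: "potential (\<lambda>j. if j \<in> range hole then x j else int K) =
      (\<Sum>(i, k)\<in>sides. exp (theta * (1 + real_of_int (x (hole i)))) * exp (- theta) ^ K)" for K
    by (simp add: potential_def algebra_simps flip: exp_of_nat_mult exp_add)
  have "(\<lambda>K. exp (- theta) ^ K) \<longlonglongrightarrow> 0"
    using theta_bounds by (intro LIMSEQ_realpow_zero) auto
  then show ?thesis
    unfolding eq case_prod_unfold
    by (intro tendsto_null_sum tendsto_mult_right_zero)
qed

lemma lyapunov_descent: "\<exists>js. set js \<subseteq> {1..n} \<and> lyapunov (walk n h js) < lyapunov h"
proof -
  define x where "x = height h"
  define y where "y K = (\<lambda>j. if j \<in> range hole then x j else int K)" for K
  have "eventually (\<lambda>K. potential (y K) < lyapunov h) sequentially"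
    using potential_raised_tendsto_0[of x] lyapunov_pos[of h]
    unfolding y_def by (rule order_tendstoD)
  \<comment> \<open>Jumps only raise sites, so \<open>K\<close> must also dominate the present
    heights; then \<open>nat (y K j - x j)\<close> is the exact number of jumps at \<open>j\<close>,
    and their order does not matter.\<close>
  moreover have "eventually (\<lambda>K. \<forall>j\<in>{1..n}. x j \<le> int K) sequentially"
  proof (intro eventually_ball_finite ballI)
    show "eventually (\<lambda>K. x j \<le> int K) sequentially" for j
      using eventually_ge_at_top[of "nat (x j)"] by eventually_elim auto
  qed simp
  ultimately have "eventually (\<lambda>K. potential (y K) < lyapunov h \<and> (\<forall>j\<in>{1..n}. x j \<le> int K)) sequentially"
    by eventually_elim auto
  then obtain K where K: "potential (y K) < lyapunov h" "\<And>j. j \<in> {1..n} \<Longrightarrow> x j \<le> int K"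
    using eventually_happens'[OF sequentially_bot] by blast
  obtain js where js: "set js \<subseteq> {1..n}" "\<And>j. j \<in> {1..n} \<Longrightarrow> count_list js j = nat (y K j - x j)"
    using ex_list_with_counts[of "{1..n}" "\<lambda>j. nat (y K j - x j)"] by auto
  obtain c where "\<And>j. j \<in> {1..n} \<Longrightarrow> height (walk n h js) j = x j + int (count_list js j) + c"
    using height_walk[OF js(1), of h] by (auto simp: x_def)
  then have "height (walk n h js) j = y K j + c" if "j \<in> {1..n}" for j
    using js(2)[OF that] K(2)[OF that] that by (auto simp: y_def)
  then have "potential (height (walk n h js)) = potential (y K)"
    by (rule potential_cong_shift)
  then have "lyapunov (walk n h js) < lyapunov h"
    using K(1) by (simp add: lyapunov_def)
  with js(1) show ?thesis by blast
qed

lemma shape_transient: "shape_transient n beta"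
  unfolding shape_transient_def
  using n_ge_5
  by (intro allI impI return_prob_less_1[of beta n lyapunov] beta_bounds lyapunov_pos
      lyapunov_superharmonic lyapunov_descent) simp

end

theorem theorem9:
  fixes beta0 beta2 :: real
  assumes "0 < beta0" and "beta0 < beta2" and "beta2 < 2 * beta0"
  shows "\<exists>B > beta0. \<forall>beta1 > B. \<forall>n \<ge> 5.
           shape_transient n (betaV beta0 beta1 beta2)"
proof (intro exI conjI allI impI)
  have "12 * beta0\<^sup>2 / (2 * beta0 - beta2) \<ge> 0"
    using assms by simp
  then show "beta0 < crystal_bound beta0 beta2"
    using assms(1) unfolding crystal_bound_def by linarith
  fix beta1 :: real and n :: nat
  assume "crystal_bound beta0 beta2 < beta1" "5 \<le> n"
  then interpret crystal beta0 beta1 beta2 n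
    using assms by unfold_locales
  show "shape_transient n (betaV beta0 beta1 beta2)"
    by (rule shape_transient)
qed

end
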